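(* Let $S$ be a cancellative semigroup, supplied with the discrete topology. Let $X$, $Y$, and $Z$ be vector sublattices of $\mathrm{C}_{\mathrm c}(S,\mathbb R)^{\sim}$ that are Banach lattices (in the induced order, each with its own norm), where $Z$ is Dedekind complete. Suppose that $\star: X\times Y\to Z$ is a bilinear map such that $x\star y\in Z^+$ whenever $x\in X^+$ and $y\in Y^+$. Define the positive linear map $\pi:X\to \mathrm{L}_{\mathrm r}(Y,Z)$ by $\pi_x(y):= x\star y$ for $x\in X$ and $y\in Y$. Suppose that the following conditions are satisfied: (1) $\operatorname{supp}(x\star y)\subseteq \operatorname{supp}x\cdot\operatorname{supp}y$ for arbitrary $x\in X^+$ and for all $y\in Y^+$ with finite support; (2) the elements of $Y^+$ with finite support are dense in $Y^+$; (3) $\chi_{\{s\}} y$ is an element of $Y$ again, whenever $y\in Y^+$ has finite support and $s\in S$. Then $\pi$ is a lattice homomorphism.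
   Context: A semigroup $S$ (not necessarily with identity) is cancellative if the maps $s\mapsto st$ and $s\mapsto ts$ from $S$ to $S$ are injective for each $t\in S$. $A_1\cdot A_2=\{a_1a_2: a_1\in A_1,\ a_2\in A_2\}$ for subsets $A_1,A_2$ of $S$. For discrete $S$, $\mathrm{C}_{\mathrm c}(S,\mathbb R)$ is the vector lattice of finitely supported real-valued functions on $S$ with pointwise ordering, and its order dual $\mathrm{C}_{\mathrm c}(S,\mathbb R)^\sim$ (the vector lattice of order bounded linear functionals) is identified as a vector lattice with the space of all real-valued functions on $S$ with pointwise ordering; the support of an element is then the set of points where the corresponding function is non-zero, and $\chi_{\{s\}}y$ is the pointwise product of $y$ with the characteristic function of $\{s\}$. Vector spaces are real. For a vector lattice $E$, $E^+$ is its set of positive elements. A Banach lattice is a vector lattice with a complete norm such that $|x|\le|y|$ implies $\|x\|\le\|y\|$. A vector lattice is Dedekind complete if every non-empty subset that is bounded above has a supremum. $\mathrm{L}_{\mathrm r}(Y,Z)$ is the space of regular operators (differences of two positive linear operators) from $Y$ to $Z$, ordered by $S\ge T$ iff $Sy\ge Ty$ for all $y\in Y^+$; since $Z$ is Dedekind complete it is a vector lattice. A linear map $T$ between vector lattices is a lattice homomorphism if $|Tx|=T|x|$ for all $x$. *)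

theory Defs
  imports
    "HOL-Analysis.Analysis"
    "HOL-Library.Function_Algebras"
    "HOL-Library.Set_Algebras"
begin

text \<open>
  The order dual of the vector lattice of finitely supported real functions on a discrete
  semigroup is identified, as a vector lattice, with all functions of type
  \<open>'s \<Rightarrow> real\<close> under pointwise operations and order. Function_Algebras and Main supply
  addition, order, \<open>sup\<close> and \<open>inf\<close>; only scalar multiplication has to be added.
\<close>

instantiation "fun" :: (type, real_vector) real_vector
begin

definition scaleR_fun :: "real \<Rightarrow> ('a \<Rightarrow> 'b) \<Rightarrow> 'a \<Rightarrow> 'b"
  where "scaleR_fun c f = (\<lambda>x. c *\<^sub>R f x)"

instance
  by standard (simp_all add: scaleR_fun_def plus_fun_def scaleR_add_right scaleR_add_left)

end

definition supp :: "('s \<Rightarrow> real) \<Rightarrow> 's set"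
  where "supp f = {s. f s \<noteq> 0}"

definition pos_cone :: "('s \<Rightarrow> real) set \<Rightarrow> ('s \<Rightarrow> real) set"
  where "pos_cone E = {x \<in> E. 0 \<le> x}"

definition cancellative_semigroup :: "'s::semigroup_mult itself \<Rightarrow> bool"
  where "cancellative_semigroup _ \<longleftrightarrow>
    (\<forall>t::'s. inj (\<lambda>s. s * t) \<and> inj (\<lambda>s. t * s))"

subsection \<open>Suprema and lattice homomorphisms\<close>

text \<open>Suprema are relative to the carrier \<open>V\<close> with order \<open>le\<close>.\<close>

definition is_sup_on :: "'v set \<Rightarrow> ('v \<Rightarrow> 'v \<Rightarrow> bool) \<Rightarrow> 'v set \<Rightarrow> 'v \<Rightarrow> bool"
  where "is_sup_on V le A u \<longleftrightarrow>
    u \<in> V \<and> (\<forall>a\<in>A. le a u) \<and> (\<forall>v\<in>V. (\<forall>a\<in>A. le a v) \<longrightarrow> le u v)"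

definition is_modulus_on :: "'v::real_vector set \<Rightarrow> ('v \<Rightarrow> 'v \<Rightarrow> bool) \<Rightarrow> 'v \<Rightarrow> 'v \<Rightarrow> bool"
  where "is_modulus_on V le x a \<longleftrightarrow> is_sup_on V le {x, - x} a"

definition linear_map_on ::
    "'v::real_vector set \<Rightarrow> 'w::real_vector set \<Rightarrow> ('v \<Rightarrow> 'w) \<Rightarrow> bool"
  where "linear_map_on V W T \<longleftrightarrow>
    (\<forall>x\<in>V. T x \<in> W) \<and>
    (\<forall>x\<in>V. \<forall>y\<in>V. T (x + y) = T x + T y) \<and>
    (\<forall>c. \<forall>x\<in>V. T (c *\<^sub>R x) = c *\<^sub>R T x)"

text \<open>
  The condition \<open>\<bar>T x\<bar> = T \<bar>x\<bar>\<close>: the modulus of \<open>x\<close> exists in \<open>V\<close>, and \<open>T\<close> maps it to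
  the modulus of \<open>T x\<close> in \<open>W\<close> (which in particular exists).
\<close>

definition lattice_hom_on ::
    "'v::real_vector set \<Rightarrow> ('v \<Rightarrow> 'v \<Rightarrow> bool) \<Rightarrow>
     'w::real_vector set \<Rightarrow> ('w \<Rightarrow> 'w \<Rightarrow> bool) \<Rightarrow> ('v \<Rightarrow> 'w) \<Rightarrow> bool"
  where "lattice_hom_on V leV W leW T \<longleftrightarrow>
    linear_map_on V W T \<and>
    (\<forall>x\<in>V. \<exists>a. is_modulus_on V leV x a \<and> is_modulus_on W leW (T x) (T a))"

subsection \<open>Banach lattices of functions\<close>

definition vector_sublattice :: "('s \<Rightarrow> real) set \<Rightarrow> bool"
  where "vector_sublattice E \<longleftrightarrow>
    subspace E \<and> (\<forall>x\<in>E. \<forall>y\<in>E. sup x y \<in> E \<and> inf x y \<in> E)"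

definition norm_on :: "'v::real_vector set \<Rightarrow> ('v \<Rightarrow> real) \<Rightarrow> bool"
  where "norm_on E n \<longleftrightarrow>
    (\<forall>x\<in>E. 0 \<le> n x) \<and>
    (\<forall>x\<in>E. n x = 0 \<longleftrightarrow> x = 0) \<and>
    (\<forall>c. \<forall>x\<in>E. n (c *\<^sub>R x) = \<bar>c\<bar> * n x) \<and>
    (\<forall>x\<in>E. \<forall>y\<in>E. n (x + y) \<le> n x + n y)"

definition complete_norm_on :: "'v::real_vector set \<Rightarrow> ('v \<Rightarrow> real) \<Rightarrow> bool"
  where "complete_norm_on E n \<longleftrightarrow>
    (\<forall>u::nat \<Rightarrow> 'v. (\<forall>k. u k \<in> E) \<and>
        (\<forall>\<epsilon>>0. \<exists>N. \<forall>i\<ge>N. \<forall>j\<ge>N. n (u i - u j) < \<epsilon>) \<longrightarrow>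
      (\<exists>x\<in>E. (\<lambda>k. n (u k - x)) \<longlonglongrightarrow> 0))"

text \<open>In a vector sublattice \<open>\<bar>x\<bar>\<close> is the pointwise \<open>sup x (- x)\<close>.\<close>

definition banach_lattice_on :: "('s \<Rightarrow> real) set \<Rightarrow> (('s \<Rightarrow> real) \<Rightarrow> real) \<Rightarrow> bool"
  where "banach_lattice_on E n \<longleftrightarrow>
    vector_sublattice E \<and> norm_on E n \<and> complete_norm_on E n \<and>
    (\<forall>x\<in>E. \<forall>y\<in>E. sup x (- x) \<le> sup y (- y) \<longrightarrow> n x \<le> n y)"

text \<open>
  Upper bounds and suprema are taken in \<open>E\<close>; a supremum in \<open>E\<close> need not be the pointwise one.
\<close>

definition dedekind_complete_on :: "('s \<Rightarrow> real) set \<Rightarrow> bool"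
  where "dedekind_complete_on E \<longleftrightarrow>
    (\<forall>A. A \<subseteq> E \<and> A \<noteq> {} \<and> (\<exists>b\<in>E. \<forall>a\<in>A. a \<le> b) \<longrightarrow> (\<exists>u. is_sup_on E (\<le>) A u))"

subsection \<open>Bilinear maps and regular operators\<close>

definition bilinear_on ::
    "('s \<Rightarrow> real) set \<Rightarrow> ('s \<Rightarrow> real) set \<Rightarrow> ('s \<Rightarrow> real) set \<Rightarrow>
     (('s \<Rightarrow> real) \<Rightarrow> ('s \<Rightarrow> real) \<Rightarrow> ('s \<Rightarrow> real)) \<Rightarrow> bool"
  where "bilinear_on X Y Z B \<longleftrightarrow>
    (\<forall>x\<in>X. linear_map_on Y Z (B x)) \<and> (\<forall>y\<in>Y. linear_map_on X Z (\<lambda>x. B x y))"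

definition positive_operator ::
    "('s \<Rightarrow> real) set \<Rightarrow> ('s \<Rightarrow> real) set \<Rightarrow> (('s \<Rightarrow> real) \<Rightarrow> ('s \<Rightarrow> real)) \<Rightarrow> bool"
  where "positive_operator Y Z T \<longleftrightarrow>
    linear_map_on Y Z T \<and> (\<forall>y\<in>pos_cone Y. T y \<in> pos_cone Z)"

text \<open>
  An operator from \<open>Y\<close> to \<open>Z\<close> is represented by the HOL function that extends it by \<open>0\<close>
  outside \<open>Y\<close>. Each operator thus has exactly one representative, and the vector space
  operations are the pointwise ones.
\<close>

definition regular_operators ::
    "('s \<Rightarrow> real) set \<Rightarrow> ('s \<Rightarrow> real) set \<Rightarrow> (('s \<Rightarrow> real) \<Rightarrow> ('s \<Rightarrow> real)) set"
  where "regular_operators Y Z = {T.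
    (\<forall>y. y \<notin> Y \<longrightarrow> T y = 0) \<and>
    (\<exists>P Q. positive_operator Y Z P \<and> positive_operator Y Z Q \<and> (\<forall>y\<in>Y. T y = P y - Q y))}"

text \<open>The order on operators; not HOL's pointwise order on functions.\<close>

definition operator_le ::
    "('s \<Rightarrow> real) set \<Rightarrow> (('s \<Rightarrow> real) \<Rightarrow> ('s \<Rightarrow> real)) \<Rightarrow>
     (('s \<Rightarrow> real) \<Rightarrow> ('s \<Rightarrow> real)) \<Rightarrow> bool"
  where "operator_le Y T U \<longleftrightarrow> (\<forall>y\<in>pos_cone Y. T y \<le> U y)"

definition left_mult_operator ::
    "('s \<Rightarrow> real) set \<Rightarrow> (('s \<Rightarrow> real) \<Rightarrow> ('s \<Rightarrow> real) \<Rightarrow> ('s \<Rightarrow> real)) \<Rightarrow>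
     ('s \<Rightarrow> real) \<Rightarrow> ('s \<Rightarrow> real) \<Rightarrow> ('s \<Rightarrow> real)"
  where "left_mult_operator Y B x = (\<lambda>y. if y \<in> Y then B x y else 0)"

end

theory Submission
  imports Defs
begin

text \<open>
  Let \<open>U\<close> be a regular operator dominating both \<open>\<pi>\<^sub>x\<close> and \<open>-\<pi>\<^sub>x\<close>. If \<open>y \<ge> 0\<close> is supported in
  one point \<open>t\<close>, then \<open>x\<^sup>+ \<star> y\<close> and \<open>x\<^sup>- \<star> y\<close> have disjoint supports, because right
  translation by \<open>t\<close> is injective; hence \<open>\<bar>x\<bar> \<star> y\<close> is the pointwise modulus of \<open>x \<star> y\<close>
  and lies below \<open>U y\<close>. Splitting \<open>y\<close> into its point components gives \<open>\<bar>x\<bar> \<star> y \<le> U y\<close>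
  for finitely supported \<open>y \<ge> 0\<close>.

  For general \<open>y \<ge> 0\<close> take finitely supported \<open>v\<^sub>k\<close> with \<open>\<parallel>y - v\<^sub>k\<parallel> < 4\<^sup>-\<^sup>k\<close>. By completeness
  there is some \<open>w\<close> with \<open>\<bar>y - v\<^sub>k\<bar> \<le> 2\<^sup>-\<^sup>k w\<close> for all \<open>k\<close>, so every regular operator sends
  \<open>v\<^sub>k\<close> to a sequence converging pointwise to the image of \<open>y\<close>.
\<close>

section \<open>Finite sums, linear maps, norms, and positive and negative parts\<close>

lemma sum_fun_apply: "(\<Sum>a\<in>A. f a) x = (\<Sum>a\<in>A. f a x)"
  by (induction A rule: infinite_finite_induct) auto

lemma linear_map_on_diff:
  assumes "linear_map_on V W T" "subspace V" "x \<in> V" "y \<in> V"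
  shows "T (x - y) = T x - T y"
proof -
  have "T (x + (-1) *\<^sub>R y) = T x + (-1) *\<^sub>R T y"
    using assms by (metis linear_map_on_def subspace_scale)
  then show ?thesis by simp
qed

lemma linear_map_on_sum:
  assumes T: "linear_map_on V W T" and V: "subspace V"
    and "finite A" "\<And>a. a \<in> A \<Longrightarrow> f a \<in> V"
  shows "T (\<Sum>a\<in>A. f a) = (\<Sum>a\<in>A. T (f a))"
  using assms(3,4)
proof (induction A rule: finite_induct)
  case empty
  have "T (0 - 0) = T 0 - T 0"
    by (rule linear_map_on_diff[OF T V]) (simp_all add: subspace_0[OF V])
  then show ?case by simp
next
  case (insert a A)
  then have "f a \<in> V" "(\<Sum>a\<in>A. f a) \<in> V"
    by (auto intro: subspace_sum[OF V])
  with T have "T (f a + (\<Sum>a\<in>A. f a)) = T (f a) + T (\<Sum>a\<in>A. f a)"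
    by (simp add: linear_map_on_def)
  with insert show ?case by simp
qed

lemma norm_on_sum_le:
  assumes n: "norm_on E n" and E: "subspace E"
    and "finite A" "\<And>a. a \<in> A \<Longrightarrow> f a \<in> E"
  shows "n (\<Sum>a\<in>A. f a) \<le> (\<Sum>a\<in>A. n (f a))"
  using assms(3,4)
proof (induction A rule: finite_induct)
  case empty
  have "n 0 = 0" using n subspace_0[OF E] by (meson norm_on_def)
  then show ?case by simp
next
  case (insert a A)
  then have "f a \<in> E" "(\<Sum>a\<in>A. f a) \<in> E"
    by (auto intro: subspace_sum[OF E])
  with n have "n (f a + (\<Sum>a\<in>A. f a)) \<le> n (f a) + n (\<Sum>a\<in>A. f a)"
    by (simp add: norm_on_def)
  with insert show ?case by force
qed

lemma norm_on_minus_commute: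
  assumes "norm_on E n" "subspace E" "x \<in> E" "y \<in> E"
  shows "n (x - y) = n (y - x)"
proof -
  have "n ((-1) *\<^sub>R (y - x)) = \<bar>-1\<bar> * n (y - x)"
    using assms by (metis norm_on_def subspace_diff)
  then show ?thesis by simp
qed

lemma vector_sublatticeD:
  assumes "vector_sublattice E"
  shows "subspace E"
    and "x \<in> E \<Longrightarrow> y \<in> E \<Longrightarrow> sup x y \<in> E"
    and "x \<in> E \<Longrightarrow> sup x 0 \<in> pos_cone E"
    and "x \<in> E \<Longrightarrow> sup (- x) 0 \<in> pos_cone E"
    and "x \<in> E \<Longrightarrow> sup x (- x) \<in> pos_cone E"
proof -
  show E: "subspace E" and S: "x \<in> E \<Longrightarrow> y \<in> E \<Longrightarrow> sup x y \<in> E" for x y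
    using assms by (auto simp: vector_sublattice_def)
  show "x \<in> E \<Longrightarrow> sup x 0 \<in> pos_cone E" "x \<in> E \<Longrightarrow> sup (- x) 0 \<in> pos_cone E"
    using S subspace_0[OF E] subspace_neg[OF E] by (auto simp: pos_cone_def)
  have "0 \<le> sup x (- x)"
    by (auto simp: le_fun_def sup_fun_def sup_real_def fun_Compl_def)
  then show "x \<in> E \<Longrightarrow> sup x (- x) \<in> pos_cone E"
    using S subspace_neg[OF E] by (auto simp: pos_cone_def)
qed

lemma fun_pos_neg_parts:
  fixes x :: "'s \<Rightarrow> real"
  shows "x = sup x 0 - sup (- x) 0" and "sup x (- x) = sup x 0 + sup (- x) 0"
  by (auto simp: fun_eq_iff sup_fun_def sup_real_def fun_Compl_def plus_fun_def)

section \<open>Norm limits and order bounds in a Banach lattice\<close>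

lemma mono_norm_limit_ge:
  assumes bl: "banach_lattice_on E n" and u: "mono u" "\<And>k. u k \<in> E" and w: "w \<in> E"
    and lim: "(\<lambda>k. n (u k - w)) \<longlonglongrightarrow> 0"
  shows "u k \<le> w"
proof -
  have vs: "vector_sublattice E" and n: "norm_on E n"
    and mono: "\<And>x y. x \<in> E \<Longrightarrow> y \<in> E \<Longrightarrow> sup x (- x) \<le> sup y (- y) \<Longrightarrow> n x \<le> n y"
    using bl by (auto simp: banach_lattice_on_def)
  note E = vector_sublatticeD(1)[OF vs]
  \<comment> \<open>For every \<open>j \<ge> k\<close> this positive part is dominated by the
    modulus of \<open>u j - w\<close>. Those norms tend to 0, so its own norm is 0.\<close>
  let ?p = "sup (u k - w) 0"
  have p: "?p \<in> E"
    using vector_sublatticeD(3)[OF vs] subspace_diff[OF E u(2) w] by (auto simp: pos_cone_def)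
  have "n ?p \<le> n (u j - w)" if "j \<ge> k" for j
  proof (rule mono[OF p subspace_diff[OF E u(2) w]])
    show "sup ?p (- ?p) \<le> sup (u j - w) (- (u j - w))"
    proof (rule le_funI)
      fix s
      have "u k s \<le> u j s" using monoD[OF u(1) that] by (simp add: le_fun_def)
      then show "sup ?p (- ?p) s \<le> sup (u j - w) (- (u j - w)) s"
        by (auto simp: sup_max max_def)
    qed
  qed
  then have "n ?p \<le> 0"
    by (intro LIMSEQ_le_const[OF lim]) auto
  then have "?p = 0" using n p by (force simp: norm_on_def)
  then show ?thesis
    by (simp add: fun_eq_iff le_fun_def sup_max max_def split: if_splits) (metis order_refl)
qed

text \<open>The series of the \<open>2 ^ k *\<^sub>R d k\<close> has terms of norm at most
  \<open>(1/2) ^ k\<close>, so its partial sums are Cauchy; their limit bounds every partial sum and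
  hence every term. This turns geometric norm decay into relatively uniform convergence with
  regulator \<open>w\<close>.\<close>

lemma banach_lattice_dominating:
  assumes bl: "banach_lattice_on E n" and d: "\<And>k. d k \<in> pos_cone E"
    and small: "\<And>k. n (d k) \<le> (1/4) ^ k"
  shows "\<exists>w\<in>E. \<forall>k. 2 ^ k *\<^sub>R d k \<le> w"
proof -
  have vs: "vector_sublattice E" and n: "norm_on E n" and compl: "complete_norm_on E n"
    using bl by (auto simp: banach_lattice_on_def)
  note E = vector_sublatticeD(1)[OF vs]
  define f where "f k = 2 ^ k *\<^sub>R d k" for k
  define u where "u k = (\<Sum>i<k. f i)" for k
  have fE: "f k \<in> E" for k
    using d[of k] subspace_scale[OF E] by (auto simp: f_def pos_cone_def)
  have f0: "0 \<le> f k s" for k s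
    using d[of k] by (auto simp: f_def pos_cone_def le_fun_def scaleR_fun_def)
  have uE: "u k \<in> E" for k
    unfolding u_def by (intro subspace_sum[OF E] fE)
  have "u k \<le> u (Suc k)" for k
    using f0 by (simp add: u_def le_fun_def)
  then have mono: "mono u" by (rule incseq_SucI)
  have nf: "n (f k) \<le> (1/2) ^ k" for k
  proof -
    have "n (f k) = 2 ^ k * n (d k)"
      using n d[of k] by (simp add: f_def norm_on_def pos_cone_def)
    also have "\<dots> \<le> 2 ^ k * (1/4) ^ k" using small by simp
    also have "\<dots> = (1/2) ^ k" by (simp flip: power_mult_distrib)
    finally show ?thesis .
  qed
  have tail: "n (u i - u j) \<le> (\<Sum>k=j..<i. (1/2) ^ k)" if "j \<le> i" for i j
  proof -
    have "u i - u j = (\<Sum>k=j..<i. f k)"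
      unfolding u_def lessThan_atLeast0 using that by (simp add: sum_diff_nat_ivl)
    then show ?thesis
      using norm_on_sum_le[OF n E, of "{j..<i}" f] fE sum_mono[of "{j..<i}" "\<lambda>k. n (f k)", OF nf]
      by fastforce
  qed
  have "\<exists>N. \<forall>i\<ge>N. \<forall>j\<ge>N. n (u i - u j) < e" if "e > 0" for e
  proof -
    have "summable (\<lambda>k. (1/2) ^ k :: real)" by simp
    then obtain N where N: "\<And>j i. j \<ge> N \<Longrightarrow> norm (\<Sum>k=j..<i. (1/2) ^ k :: real) < e"
      using \<open>e > 0\<close> unfolding summable_Cauchy by blast
    have "n (u i - u j) < e" if "j \<ge> N" "j \<le> i" for i j
      using tail[of j i] N[of j i] that by auto
    then have "n (u i - u j) < e" if "j \<ge> N" "i \<ge> N" for i j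
      using that norm_on_minus_commute[OF n E uE uE, of i j] by (metis nle_le)
    then show ?thesis by blast
  qed
  then obtain w where w: "w \<in> E" "(\<lambda>k. n (u k - w)) \<longlonglongrightarrow> 0"
    using compl uE unfolding complete_norm_on_def by blast
  have "f k \<le> w" for k
  proof -
    \<comment> \<open>The partial sum \<open>u k\<close> stops before index \<open>k\<close>, so
      \<open>f k\<close> first enters in \<open>u (Suc k)\<close>.\<close>
    have "f k \<le> u (Suc k)"
      using f0 by (auto simp: u_def le_fun_def sum_fun_apply intro!: sum_nonneg)
    also have "\<dots> \<le> w" by (rule mono_norm_limit_ge[OF bl mono uE w])
    finally show ?thesis .
  qed
  with w show ?thesis by (auto simp: f_def)
qed

section \<open>Positive operators and passage to the limit\<close>

lemma positive_operator_mono: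
  assumes "positive_operator Y Z P" "subspace Y" "x \<in> Y" "y \<in> Y" "x \<le> y"
  shows "P x \<le> P y"
proof -
  have "y - x \<in> pos_cone Y"
    using assms subspace_diff[of Y y x] by (auto simp: pos_cone_def le_fun_def)
  then have "0 \<le> P (y - x)"
    using assms by (auto simp: positive_operator_def pos_cone_def)
  then show ?thesis
    using assms linear_map_on_diff[of Y Z P y x] by (simp add: positive_operator_def le_fun_def)
qed

text \<open>Positivity supplies the continuity: a bound of \<open>y - v k\<close> by small multiples
  of a single \<open>w\<close> is carried by \<open>P\<close> and \<open>Q\<close> to bounds by the
  same multiples of \<open>P w\<close> and \<open>Q w\<close>, which vanish pointwise.\<close>

lemma positive_operator_le_closed:
  assumes bl: "banach_lattice_on Y n"
    and P: "positive_operator Y Z P" and Q: "positive_operator Y Z Q" and y: "y \<in> Y"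
    and dense: "\<And>e. e > 0 \<Longrightarrow> \<exists>v\<in>Y. Q v \<le> P v \<and> n (y - v) < e"
  shows "Q y \<le> P y"
proof -
  have vs: "vector_sublattice Y" and norm: "norm_on Y n"
    and mono: "\<And>x y. x \<in> Y \<Longrightarrow> y \<in> Y \<Longrightarrow> sup x (- x) \<le> sup y (- y) \<Longrightarrow> n x \<le> n y"
    using bl by (auto simp: banach_lattice_on_def)
  note E = vector_sublatticeD(1)[OF vs]
  have linP: "linear_map_on Y Z P" and linQ: "linear_map_on Y Z Q"
    using P Q by (auto simp: positive_operator_def)
  \<comment> \<open>The rate \<open>(1/4) ^ k\<close> leaves room for the weights
    \<open>2 ^ k\<close> in the dominating series.\<close>
  have "\<exists>v\<in>Y. Q v \<le> P v \<and> n (y - v) < (1/4) ^ k" for k :: nat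
    by (rule dense) simp
  then obtain v where v: "\<And>k. v k \<in> Y" "\<And>k. Q (v k) \<le> P (v k)"
      "\<And>k::nat. n (y - v k) < (1/4) ^ k"
    by metis
  define d where "d k = sup (y - v k) (- (y - v k))" for k
  have yv: "y - v k \<in> Y" for k by (rule subspace_diff[OF E y v(1)])
  have d: "d k \<in> pos_cone Y" for k
    unfolding d_def by (rule vector_sublatticeD(5)[OF vs yv])
  then have dY: "d k \<in> Y" and d0: "0 \<le> d k" for k by (auto simp: pos_cone_def)
  have "n (d k) \<le> n (y - v k)" for k
  proof (rule mono[OF dY yv])
    have "- d k \<le> d k" using d0[of k] by (force simp: le_fun_def)
    then show "sup (d k) (- d k) \<le> sup (y - v k) (- (y - v k))"
      unfolding d_def[symmetric] by simp
  qed
  then have "n (d k) \<le> (1/4) ^ k" for k using v(3)[of k] by (meson less_imp_le order_trans)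
  from banach_lattice_dominating[OF bl d this]
  obtain w where w: "w \<in> Y" "\<And>k. 2 ^ k *\<^sub>R d k \<le> w" by blast
  \<comment> \<open>Write \<open>Q y - P y\<close> as
    \<open>Q (y - v k) + (Q (v k) - P (v k)) + P (v k - y)\<close>. The middle term is at most 0,
    and the outer ones are controlled by \<open>w\<close>.\<close>
  have bound: "Q y s - P y s \<le> (1/2) ^ k * (Q w s + P w s)" for k s
  proof -
    have sc: "(1/2) ^ k *\<^sub>R w \<in> Y" by (rule subspace_scale[OF E w(1)])
    have dw: "d k \<le> (1/2) ^ k *\<^sub>R w"
    proof (rule le_funI)
      fix s
      have "2 ^ k * d k s \<le> w s" using w(2)[of k] by (simp add: le_fun_def scaleR_fun_def)
      then show "d k s \<le> ((1/2) ^ k *\<^sub>R w) s"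
        by (simp add: scaleR_fun_def field_simps)
    qed
    have vk: "v k - y \<in> Y" by (rule subspace_diff[OF E v(1) y])
    have "y - v k \<le> d k" "v k - y \<le> d k"
      by (auto simp: d_def le_fun_def sup_fun_def)
    then have 1: "Q (y - v k) \<le> Q ((1/2) ^ k *\<^sub>R w)" "P (v k - y) \<le> P ((1/2) ^ k *\<^sub>R w)"
      using dw by (auto intro!: positive_operator_mono[OF P E] positive_operator_mono[OF Q E]
          yv vk sc intro: order_trans)
    have "Q ((1/2) ^ k *\<^sub>R w) = (1/2) ^ k *\<^sub>R Q w" "P ((1/2) ^ k *\<^sub>R w) = (1/2) ^ k *\<^sub>R P w"
      using linP linQ w(1) by (auto simp: linear_map_on_def)
    with 1 have "Q y s - Q (v k) s \<le> (1/2) ^ k * Q w s" "P (v k) s - P y s \<le> (1/2) ^ k * P w s"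
      using linear_map_on_diff[OF linQ E y v(1)] linear_map_on_diff[OF linP E v(1) y]
      by (auto simp: le_fun_def scaleR_fun_def)
    moreover have "Q (v k) s \<le> P (v k) s" using v(2)[of k] by (simp add: le_fun_def)
    ultimately show ?thesis by (simp add: algebra_simps)
  qed
  show ?thesis
  proof (rule le_funI)
    fix s
    have "(\<lambda>k. (1/2) ^ k * (Q w s + P w s)) \<longlonglongrightarrow> 0"
      by (rule tendsto_mult_left_zero) (simp add: LIMSEQ_realpow_zero)
    then have "Q y s - P y s \<le> 0"
      by (rule LIMSEQ_le_const) (use bound in auto)
    then show "Q y s \<le> P y s" by simp
  qed
qed

section \<open>Point components and disjoint supports\<close>

lemma sum_indicator_supp:
  fixes y :: "'s \<Rightarrow> real"
  assumes "finite (supp y)"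
  shows "(\<Sum>s\<in>supp y. indicator {s} * y) = y"
proof
  fix t
  have "(\<Sum>s\<in>supp y. indicator {s} * y) t = (\<Sum>s\<in>supp y. if t = s then y t else 0)"
    unfolding sum_fun_apply by (rule sum.cong) (auto simp: indicator_def)
  also have "\<dots> = y t" using assms by (simp add: supp_def)
  finally show "(\<Sum>s\<in>supp y. indicator {s} * y) t = y t" .
qed

text \<open>At each point \<open>p\<close> or \<open>q\<close> vanishes, so \<open>p + q\<close> is
  the pointwise modulus of \<open>p - q\<close>.\<close>

lemma modulus_le_of_disjoint_supp:
  fixes p q r :: "'s \<Rightarrow> real"
  assumes "supp p \<inter> supp q = {}" "0 \<le> p" "0 \<le> q" "p - q \<le> r" "q - p \<le> r"
  shows "p + q \<le> r"
proof (rule le_funI)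
  fix s
  have "p s = 0 \<or> q s = 0" using assms(1) by (auto simp: supp_def)
  moreover have "p s - q s \<le> r s" "q s - p s \<le> r s" "0 \<le> p s" "0 \<le> q s"
    using assms by (auto simp: le_fun_def)
  ultimately show "(p + q) s \<le> r s" by auto
qed

text \<open>The positive and negative parts of \<open>x\<close> have disjoint supports, and an
  injective right translation keeps them disjoint. This is where cancellation enters.\<close>

lemma disjoint_supp_translate:
  fixes x :: "'s::semigroup_mult \<Rightarrow> real"
  assumes "cancellative_semigroup TYPE('s)"
  shows "(supp (sup x 0) * {t}) \<inter> (supp (sup (- x) 0) * {t}) = {}"
proof -
  have "inj (\<lambda>s::'s. s * t)"
    using assms by (simp add: cancellative_semigroup_def)
  then have "(supp (sup x 0) * {t}) \<inter> (supp (sup (- x) 0) * {t})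
      = (\<lambda>s. s * t) ` (supp (sup x 0) \<inter> supp (sup (- x) 0))"
    by (simp add: image_Int) (auto simp: set_times_def)
  also have "supp (sup x 0) \<inter> supp (sup (- x) 0) = {}"
    by (auto simp: supp_def sup_max max_def split: if_splits)
  finally show ?thesis by (simp only: image_empty)
qed

section \<open>Left multiplication and the modulus of an operator\<close>

theorem theorem10p4:
  fixes X Y Z :: "('s::semigroup_mult \<Rightarrow> real) set"
    and normX normY normZ :: "('s \<Rightarrow> real) \<Rightarrow> real"
    and star :: "('s \<Rightarrow> real) \<Rightarrow> ('s \<Rightarrow> real) \<Rightarrow> ('s \<Rightarrow> real)"  (infixl \<open>\<star>\<close> 70)
  assumes "cancellative_semigroup TYPE('s)"
    and "banach_lattice_on X normX"
    and "banach_lattice_on Y normY"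
    and "banach_lattice_on Z normZ"
    and "dedekind_complete_on Z"
    and "bilinear_on X Y Z (\<star>)"
    and "\<And>x y. x \<in> pos_cone X \<Longrightarrow> y \<in> pos_cone Y \<Longrightarrow> x \<star> y \<in> pos_cone Z"
    and "\<And>x y. x \<in> pos_cone X \<Longrightarrow> y \<in> pos_cone Y \<Longrightarrow> finite (supp y) \<Longrightarrow>
           supp (x \<star> y) \<subseteq> supp x * supp y"
    and "\<And>y \<epsilon>. y \<in> pos_cone Y \<Longrightarrow> \<epsilon> > 0 \<Longrightarrow>
           \<exists>v\<in>pos_cone Y. finite (supp v) \<and> normY (y - v) < \<epsilon>"
    and "\<And>y s. y \<in> pos_cone Y \<Longrightarrow> finite (supp y) \<Longrightarrow> indicator {s} * y \<in> Y"
  shows "lattice_hom_on X (\<le>) (regular_operators Y Z) (operator_le Y) (left_mult_operator Y (\<star>))"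
proof -
  note cancel = assms(1) and bil = assms(6) and pos = assms(7) and supp = assms(8)
    and dense = assms(9) and ind = assms(10)
  have vX: "vector_sublattice X" and vY: "vector_sublattice Y" and vZ: "vector_sublattice Z"
    using assms(2-4) by (auto simp: banach_lattice_on_def)
  note X = vector_sublatticeD(1)[OF vX] and Y = vector_sublatticeD(1)[OF vY]
    and Z = vector_sublatticeD(1)[OF vZ]
  have linR: "linear_map_on Y Z (\<lambda>y. x \<star> y)" if "x \<in> X" for x
    using bil that by (simp add: bilinear_on_def)
  have linL: "linear_map_on X Z (\<lambda>x. x \<star> y)" if "y \<in> Y" for y
    using bil that by (simp add: bilinear_on_def)
  have posop: "positive_operator Y Z (\<lambda>y. x \<star> y)" if "x \<in> pos_cone X" for x
    using linR pos that by (auto simp: positive_operator_def pos_cone_def)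
  let ?p = "\<lambda>x::'s \<Rightarrow> real. sup x 0" and ?q = "\<lambda>x::'s \<Rightarrow> real. sup (- x) 0"
  have pX: "?p x \<in> X" and qX: "?q x \<in> X" and pc: "?p x \<in> pos_cone X" and qc: "?q x \<in> pos_cone X"
    if "x \<in> X" for x
    using vector_sublatticeD(3,4)[OF vX that] by (auto simp: pos_cone_def)
  have split: "x \<star> y = ?p x \<star> y - ?q x \<star> y" "sup x (- x) \<star> y = ?p x \<star> y + ?q x \<star> y"
    if "x \<in> X" "y \<in> Y" for x y
  proof -
    show "x \<star> y = ?p x \<star> y - ?q x \<star> y"
      using linear_map_on_diff[OF linL[OF that(2)] X pX[OF that(1)] qX[OF that(1)]]
      by (simp flip: fun_pos_neg_parts(1))
    show "sup x (- x) \<star> y = ?p x \<star> y + ?q x \<star> y"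
      using linL[OF that(2)] pX[OF that(1)] qX[OF that(1)]
      by (simp add: linear_map_on_def fun_pos_neg_parts(2))
  qed
  let ?pi = "left_mult_operator Y (\<star>)"
  \<comment> \<open>The positive and negative parts of \<open>x\<close> give the two positive
    operators whose difference is required.\<close>
  have reg: "?pi x \<in> regular_operators Y Z" if "x \<in> X" for x
    unfolding regular_operators_def left_mult_operator_def
    using posop[OF pc[OF that]] posop[OF qc[OF that]] split(1)[OF that] by auto
  have lin: "linear_map_on X (regular_operators Y Z) ?pi"
    unfolding linear_map_on_def
  proof (intro conjI ballI allI)
    \<comment> \<open>Equality of representatives is tested at all functions; outside
      \<open>Y\<close> both sides are 0.\<close>
    show "?pi (x + x') = ?pi x + ?pi x'" if "x \<in> X" "x' \<in> X" for x x'
      using linL that by (auto simp: fun_eq_iff linear_map_on_def left_mult_operator_def)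
    show "?pi (c *\<^sub>R x) = c *\<^sub>R ?pi x" if "x \<in> X" for c x
      using linL that
      by (auto simp: fun_eq_iff linear_map_on_def left_mult_operator_def scaleR_fun_def)
  qed (rule reg)
  \<comment> \<open>This is minimality among the regular upper bounds \<open>U\<close>, tested on
    the positive cone of \<open>Y\<close>.\<close>
  have least: "sup x (- x) \<star> y \<le> U y"
    if x: "x \<in> X" and U: "U \<in> regular_operators Y Z"
      and U1: "operator_le Y (?pi x) U" and U2: "operator_le Y (- ?pi x) U"
      and y: "y \<in> pos_cone Y" for x U y
  proof -
    let ?a = "sup x (- x)"
    have aX: "?a \<in> X" and ac: "?a \<in> pos_cone X"
      using vector_sublatticeD(5)[OF vX x] by (auto simp: pos_cone_def)
    obtain P Q where P: "positive_operator Y Z P" and Q: "positive_operator Y Z Q"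
      and PQ: "\<And>y. y \<in> Y \<Longrightarrow> U y = P y - Q y"
      using U by (auto simp: regular_operators_def)
    have linP: "linear_map_on Y Z P" and linQ: "linear_map_on Y Z Q"
      using P Q by (auto simp: positive_operator_def)
    \<comment> \<open>Inclusion in \<open>{t}\<close> admits \<open>y = 0\<close>, so the estimate
      applies to the component at any \<open>s\<close>, even one outside the support.\<close>
    have point: "?a \<star> y \<le> U y" if y: "y \<in> pos_cone Y" and t: "supp y \<subseteq> {t}" for y t
    proof -
      have yY: "y \<in> Y" and fin: "finite (supp y)"
        using y t by (auto simp: pos_cone_def finite_subset)
      have sub: "supp (?p x \<star> y) \<subseteq> supp (?p x) * {t}" "supp (?q x \<star> y) \<subseteq> supp (?q x) * {t}"
        using supp[OF pc[OF x] y fin] supp[OF qc[OF x] y fin] t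
          set_times_mono2[OF order_refl t] by blast+
      then have "supp (?p x \<star> y) \<inter> supp (?q x \<star> y) = {}"
        using disjoint_supp_translate[OF cancel, of x t] Int_mono[OF sub] by simp
      moreover have "0 \<le> ?p x \<star> y" "0 \<le> ?q x \<star> y"
        using pos[OF pc[OF x] y] pos[OF qc[OF x] y] by (auto simp: pos_cone_def)
      moreover have "?p x \<star> y - ?q x \<star> y \<le> U y"
        using U1 y yY split(1)[OF x yY] by (auto simp: operator_le_def left_mult_operator_def)
      moreover have "?q x \<star> y - ?p x \<star> y \<le> U y"
        using bspec[OF U2[unfolded operator_le_def] y]
        by (simp add: left_mult_operator_def yY split(1)[OF x yY])
      ultimately show ?thesis
        unfolding split(2)[OF x yY] by (rule modulus_le_of_disjoint_supp)
    qed
    have finite_case: "?a \<star> y \<le> U y" if y: "y \<in> pos_cone Y" and fin: "finite (supp y)" for y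
    proof -
      let ?y = "\<lambda>s. indicator {s} * y"
      have yY: "?y s \<in> Y" for s by (rule ind[OF y fin])
      have yc: "?y s \<in> pos_cone Y" for s
        using y yY[of s] by (auto simp: pos_cone_def le_fun_def)
      have "?a \<star> y = ?a \<star> (\<Sum>s\<in>supp y. ?y s)"
        by (simp add: sum_indicator_supp[OF fin])
      also have "\<dots> = (\<Sum>s\<in>supp y. ?a \<star> ?y s)"
        by (rule linear_map_on_sum[OF linR[OF aX] Y fin yY])
      also have "\<dots> \<le> (\<Sum>s\<in>supp y. U (?y s))"
      proof (rule le_funI)
        fix r
        have "(?a \<star> ?y s) r \<le> U (?y s) r" for s
          using point[OF yc, of s s] by (auto simp: le_fun_def supp_def indicator_def)
        then show "(\<Sum>s\<in>supp y. ?a \<star> ?y s) r \<le> (\<Sum>s\<in>supp y. U (?y s)) r"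
          by (simp add: sum_fun_apply sum_mono)
      qed
      \<comment> \<open>Regularity describes \<open>U\<close> on \<open>Y\<close> as
        \<open>P - Q\<close>, so its additivity is obtained from the linearity of \<open>P\<close>
        and \<open>Q\<close>.\<close>
      also have "\<dots> = (\<Sum>s\<in>supp y. P (?y s)) - (\<Sum>s\<in>supp y. Q (?y s))"
        by (simp add: PQ[OF yY] sum_subtractf)
      also have "\<dots> = P (\<Sum>s\<in>supp y. ?y s) - Q (\<Sum>s\<in>supp y. ?y s)"
        by (simp only: linear_map_on_sum[OF linP Y fin yY] linear_map_on_sum[OF linQ Y fin yY])
      also have "\<dots> = U y"
        using y PQ[of y] by (simp add: sum_indicator_supp[OF fin] pos_cone_def)
      finally show ?thesis .
    qed
    have yY: "y \<in> Y" using y by (simp add: pos_cone_def)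
    \<comment> \<open>Moving \<open>Q\<close> to the left turns the claim into a comparison of two
      positive operators, \<open>?R\<close> and \<open>P\<close>, the form in which density can be
      used.\<close>
    let ?R = "\<lambda>y. Q y + ?a \<star> y"
    have R: "positive_operator Y Z ?R"
      using Q posop[OF ac] subspace_add[OF Z]
      by (auto simp: positive_operator_def linear_map_on_def pos_cone_def scaleR_add_right
          add_nonneg_nonneg le_fun_def)
    have "?R y \<le> P y"
    proof (rule positive_operator_le_closed[OF assms(3) P R yY])
      fix e :: real assume "e > 0"
      from dense[OF y this] obtain v
        where v: "v \<in> pos_cone Y" "finite (supp v)" "normY (y - v) < e" by blast
      then have "v \<in> Y" by (simp add: pos_cone_def)
      moreover have "?R v \<le> P v"
        using finite_case[OF v(1,2)] PQ[OF \<open>v \<in> Y\<close>] by (simp add: le_fun_def algebra_simps)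
      ultimately show "\<exists>v\<in>Y. ?R v \<le> P v \<and> normY (y - v) < e" using v by blast
    qed
    then show ?thesis unfolding PQ[OF yY] by (simp add: le_fun_def algebra_simps)
  qed
  \<comment> \<open>The pointwise supremum lies in the sublattice \<open>X\<close>, so it is also
    the supremum relative to \<open>X\<close>.\<close>
  have "is_modulus_on X (\<le>) x (sup x (- x))" if "x \<in> X" for x
    using vector_sublatticeD(5)[OF vX that]
    by (auto simp: is_modulus_on_def is_sup_on_def pos_cone_def)
  moreover have "is_modulus_on (regular_operators Y Z) (operator_le Y) (?pi x) (?pi (sup x (- x)))"
    if x: "x \<in> X" for x
    unfolding is_modulus_on_def is_sup_on_def
  proof (intro conjI ballI impI)
    have aX: "sup x (- x) \<in> X"
      using vector_sublatticeD(5)[OF vX x] by (simp add: pos_cone_def)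
    show "?pi (sup x (- x)) \<in> regular_operators Y Z" by (rule reg[OF aX])
    \<comment> \<open>The products of \<open>y\<close> with the two parts of \<open>x\<close> are
      nonnegative, so their sum bounds their difference and its negative.\<close>
    have "x \<star> y \<le> sup x (- x) \<star> y \<and> - (x \<star> y) \<le> sup x (- x) \<star> y" if y: "y \<in> pos_cone Y" for y
    proof -
      have yY: "y \<in> Y" using y by (simp add: pos_cone_def)
      have "0 \<le> ?p x \<star> y" "0 \<le> ?q x \<star> y"
        using pos[OF pc[OF x] y] pos[OF qc[OF x] y] by (auto simp: pos_cone_def)
      then show ?thesis
        unfolding split[OF x yY] by (auto simp: le_fun_def)
    qed
    then show "operator_le Y T (?pi (sup x (- x)))" if "T \<in> {?pi x, - ?pi x}" for T
      using that by (auto simp: operator_le_def left_mult_operator_def pos_cone_def)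
    show "operator_le Y (?pi (sup x (- x))) U"
      if "U \<in> regular_operators Y Z" "\<forall>T\<in>{?pi x, - ?pi x}. operator_le Y T U" for U
      using least[OF x that(1)] that(2) by (auto simp: operator_le_def left_mult_operator_def pos_cone_def)
  qed
  ultimately show ?thesis
    using lin by (auto simp: lattice_hom_on_def)
qed

end
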